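(* Let $f:\mathbb{R}^n\to\mathbb{R}$ be convex and $L_f$-smooth, and let $(y_i)_{i\in\mathcal{I}_j}$ be the finite nonempty family of bundle points. Let $f_j=\operatorname{cl}\big(\operatorname{conv}\{\hat f:\hat f\in\mathcal{F}_{L_f}(\mathcal{I}_j)\}\big)$ be the closure of the convex hull of all functions in $\mathcal{F}_{L_f}(\mathcal{I}_j)$. Then $f_j\in\mathcal{F}_{L_f}(\mathcal{I}_j)$; thus $f_j=\operatorname{conv}\{\hat f:\hat f\in\mathcal{F}_{L_f}(\mathcal{I}_j)\}$. Moreover, $f_j$ is the lowest element of $\mathcal{F}_{L_f}(\mathcal{I}_j)$, i.e. $$\forall \hat f\in\mathcal{F}_{L_f}(\mathcal{I}_j),\ \forall x\in\mathbb{R}^n,\quad f_j(x)\le \hat f(x).$$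
   Context: A function is $L_f$-smooth if it is differentiable with $\|\nabla f(y)-\nabla f(x)\|\le L_f\|x-y\|$ for all $x,y\in\mathbb{R}^n$ (Euclidean norm, $L_f>0$). $\mathcal{F}_{L_f}(\mathcal{I}_j)$ is the set of convex, $L_f$-smooth functions $\hat f:\mathbb{R}^n\to\mathbb{R}$ with $\hat f(y_i)=f(y_i)$ and $\nabla\hat f(y_i)=\nabla f(y_i)$ for all $i\in\mathcal{I}_j$. The convex hull $\operatorname{conv}\{h_i:i\in\mathcal I\}$ of a collection of functions is the convex hull of its pointwise infimum, i.e. the greatest convex function below all the $h_i$. $\operatorname{cl}$ denotes the closure (lower semicontinuous hull) of a proper convex function. *)

theory Defs
  imports "HOL-Analysis.Analysis"
begin

definition grad :: "('a::real_inner \<Rightarrow> real) \<Rightarrow> 'a \<Rightarrow> 'a" where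
  "grad f x = (THE D. GDERIV f x :> D)"

definition smooth_with :: "real \<Rightarrow> ('a::real_inner \<Rightarrow> real) \<Rightarrow> bool" where
  "smooth_with L f \<longleftrightarrow>
     (\<forall>x. f differentiable (at x)) \<and> (\<forall>x y. norm (grad f y - grad f x) \<le> L * norm (x - y))"

definition smooth_interpolants ::
  "real \<Rightarrow> ('a::real_inner \<Rightarrow> real) \<Rightarrow> ('i \<Rightarrow> 'a) \<Rightarrow> 'i set \<Rightarrow> ('a \<Rightarrow> real) set" where
  "smooth_interpolants L f y I =
     {g. convex_on UNIV g \<and> smooth_with L g \<and>
         (\<forall>i\<in>I. g (y i) = f (y i) \<and> grad g (y i) = grad f (y i))}"

text \<open>The convex hull of a family of functions may a priori take infinite values, so hulls are
  formed among \<^typ>\<open>ereal\<close>-valued functions.  Convexity of such a function is convexity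
  of its epigraph, which avoids the sum of opposite infinities.\<close>

definition ereal_convex :: "('a::real_vector \<Rightarrow> ereal) \<Rightarrow> bool" where
  "ereal_convex h \<longleftrightarrow> convex {(x, r::real). h x \<le> ereal r}"

definition lower_semicontinuous :: "('a::topological_space \<Rightarrow> ereal) \<Rightarrow> bool" where
  "lower_semicontinuous h \<longleftrightarrow> (\<forall>c. open {x. c < h x})"

text \<open>Below, order, suprema and infima of functions are pointwise.\<close>

definition convex_hull_fun :: "('a::real_vector \<Rightarrow> ereal) \<Rightarrow> 'a \<Rightarrow> ereal" where
  "convex_hull_fun g = Sup {h. ereal_convex h \<and> h \<le> g}"

definition conv_funs :: "('a::real_vector \<Rightarrow> real) set \<Rightarrow> 'a \<Rightarrow> ereal" where
  "conv_funs H = convex_hull_fun (\<lambda>x. INF h\<in>H. ereal (h x))"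

text \<open>On proper convex functions the closure is the lower semicontinuous hull.  (Another
  convention exists for functions attaining \<^term>\<open>-\<infinity>\<close>; it is not needed here.)\<close>

definition cl_fun :: "('a::topological_space \<Rightarrow> ereal) \<Rightarrow> 'a \<Rightarrow> ereal" where
  "cl_fun g = Sup {h. lower_semicontinuous h \<and> h \<le> g}"

lemma gderiv_grad:
  assumes "GDERIV f x :> D" shows "grad f x = D"
proof -
  have "D' = D" if "GDERIV f x :> D'" for D'
  proof -
    have "(\<lambda>h. inner h D') = (\<lambda>h. inner h D)"
      using that assms unfolding gderiv_def by (rule has_derivative_unique)
    then have "\<forall>h. inner h D' = inner h D"
      by (rule fun_eq_iff[THEN iffD1])
    then show ?thesis
      by (rule vector_eq_ldot[THEN iffD1])
  qed
  with assms show ?thesis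
    unfolding grad_def by (rule the_equality)
qed

lemma differentiable_imp_gderiv_grad:
  fixes f :: "'a::euclidean_space \<Rightarrow> real"
  assumes "f differentiable (at x)"
  shows "GDERIV f x :> grad f x"
proof -
  obtain f' where f': "(f has_derivative f') (at x)"
    using assms unfolding differentiable_def by blast
  then interpret linear f' by (rule has_derivative_linear)
  have "f' = (\<lambda>h. inner h (\<Sum>b\<in>Basis. f' b *\<^sub>R b))"
  proof
    fix h
    have "f' h = f' (\<Sum>b\<in>Basis. inner h b *\<^sub>R b)"
      by (simp add: euclidean_representation)
    also have "\<dots> = inner h (\<Sum>b\<in>Basis. f' b *\<^sub>R b)"
      by (simp add: sum scale inner_sum_right mult.commute)
    finally show "f' h = inner h (\<Sum>b\<in>Basis. f' b *\<^sub>R b)" .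
  qed
  with f' have "GDERIV f x :> (\<Sum>b\<in>Basis. f' b *\<^sub>R b)"
    unfolding gderiv_def by (simp only:)
  with gderiv_grad[OF this] show ?thesis
    by (simp only:)
qed

lemma ereal_convex_Sup:
  assumes "\<And>h. h \<in> A \<Longrightarrow> ereal_convex h"
  shows "ereal_convex (Sup A)"
proof -
  have "{(x, r::real). (Sup A) x \<le> ereal r} = (\<Inter>h\<in>A. {(x, r). h x \<le> ereal r})"
    by (auto simp: SUP_le_iff)
  then show ?thesis
    using assms unfolding ereal_convex_def by (auto intro: convex_INT)
qed

lemma ereal_convex_ereal_iff:
  "ereal_convex (\<lambda>x. ereal (g x)) \<longleftrightarrow> convex_on UNIV g"
proof -
  have "{(x, r::real). ereal (g x) \<le> ereal r} = epigraph UNIV g"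
    by (auto simp: epigraph_def)
  then show ?thesis
    unfolding ereal_convex_def by (simp add: convex_epigraph)
qed

lemma lower_semicontinuous_Sup:
  assumes "\<And>h. h \<in> A \<Longrightarrow> lower_semicontinuous h"
  shows "lower_semicontinuous (Sup A)"
proof -
  have "{x. c < (Sup A) x} = (\<Union>h\<in>A. {x. c < h x})" for c
    by (auto simp: less_SUP_iff)
  then show ?thesis
    using assms unfolding lower_semicontinuous_def by auto
qed

text \<open>The hulls are indeed the greatest convex, respectively lower semicontinuous, minorants.\<close>

lemma conv_funs_greatest:
  "ereal_convex (conv_funs H)"
  "h \<in> H \<Longrightarrow> conv_funs H x \<le> ereal (h x)"
  "ereal_convex k \<Longrightarrow> (\<And>h x. h \<in> H \<Longrightarrow> k x \<le> ereal (h x)) \<Longrightarrow> k x \<le> conv_funs H x"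
proof -
  show "ereal_convex (conv_funs H)"
    unfolding conv_funs_def convex_hull_fun_def by (rule ereal_convex_Sup) auto
  have "conv_funs H \<le> (\<lambda>x. INF h\<in>H. ereal (h x))"
    unfolding conv_funs_def convex_hull_fun_def by (rule Sup_least) auto
  then have "conv_funs H x \<le> (INF h\<in>H. ereal (h x))"
    by (rule le_funD)
  then show "conv_funs H x \<le> ereal (h x)" if "h \<in> H"
    using that by (rule order_trans[OF _ INF_lower])
  show "k x \<le> conv_funs H x"
    if "ereal_convex k" "\<And>h x. h \<in> H \<Longrightarrow> k x \<le> ereal (h x)"
  proof -
    have "k \<le> conv_funs H"
      unfolding conv_funs_def convex_hull_fun_def
      using that by (intro Sup_upper) (auto simp: le_fun_def le_INF_iff)
    then show ?thesis by (rule le_funD)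
  qed
qed

lemma cl_fun_greatest:
  "lower_semicontinuous (cl_fun g)"
  "cl_fun g \<le> g"
  "lower_semicontinuous k \<Longrightarrow> k \<le> g \<Longrightarrow> k \<le> cl_fun g"
proof -
  show "lower_semicontinuous (cl_fun g)"
    unfolding cl_fun_def by (rule lower_semicontinuous_Sup) simp
  show "cl_fun g \<le> g"
    unfolding cl_fun_def by (rule Sup_least) simp
  show "k \<le> cl_fun g" if "lower_semicontinuous k" "k \<le> g"
    unfolding cl_fun_def using that by (intro Sup_upper) simp
qed

end

theory Submission
  imports Defs
begin

text \<open>Under convexity, being \<open>L\<close>-smooth amounts to a bound on the gap between a chord and the
  function, uniform in the base point.  For a fixed offset this bound says that a
  combination of translates of the function, minus a constant, stays below the function itself.
  If \<open>c\<close> is the convex hull of the family, then the same combination of translates of \<open>c\<close> is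
  convex and lies below every member, hence below \<open>c\<close>; so \<open>c\<close> inherits the bound without any
  representation of the hull by convex combinations.  The common tangents at the bundle points make
  \<open>c\<close> finite and force its values and gradients there.\<close>

text \<open>Equivalently, \<open>\<lambda>x. g x - L / 2 * (norm x)\<^sup>2\<close> is concave.
  Describing the chord by its dividing point \<open>w\<close> and the difference \<open>d\<close> of
  its ends makes both ends translates of \<open>w\<close>.\<close>

definition chord_gap :: "real \<Rightarrow> ('a::real_inner \<Rightarrow> real) \<Rightarrow> bool" where
  "chord_gap L g \<longleftrightarrow> (\<forall>w d t. 0 \<le> t \<and> t \<le> 1 \<longrightarrow>
     t * g (w + (1 - t) *\<^sub>R d) + (1 - t) * g (w - t *\<^sub>R d)
       \<le> g w + L / 2 * t * (1 - t) * (norm d)\<^sup>2)"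

section \<open>From smoothness to the chord gap\<close>

lemma GDERIV_along_line:
  assumes "GDERIV f (x + t *\<^sub>R d) :> D"
  shows "((\<lambda>s. f (x + s *\<^sub>R d)) has_real_derivative (d \<bullet> D)) (at t)"
proof -
  have "(f has_derivative (\<lambda>h. h \<bullet> D)) (at (x + t *\<^sub>R d))"
    using assms by (simp add: gderiv_def)
  then have "((\<lambda>s. f (x + s *\<^sub>R d)) has_derivative (\<lambda>s. (s *\<^sub>R d) \<bullet> D)) (at t)"
    by (rule has_derivative_compose[rotated]) (auto intro!: derivative_eq_intros)
  then show ?thesis
    by (simp add: has_field_derivative_def mult.commute[of _ "d \<bullet> D"])
qed

lemma convex_on_compose_affine:
  assumes "convex_on UNIV f" and "linear l"
  shows "convex_on UNIV (\<lambda>x. f (a + l x))"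
proof (rule convex_onI)
  fix t :: real and x z
  assume "0 < t" "t < 1"
  then have "f ((1 - t) *\<^sub>R (a + l x) + t *\<^sub>R (a + l z)) \<le> (1 - t) * f (a + l x) + t * f (a + l z)"
    using assms(1) by (intro convex_onD) auto
  moreover have "(1 - t) *\<^sub>R (a + l x) + t *\<^sub>R (a + l z) = a + l ((1 - t) *\<^sub>R x + t *\<^sub>R z)"
    by (simp add: linear_add[OF assms(2)] linear_diff[OF assms(2)] linear_scale[OF assms(2)] scaleR_add_right scaleR_left_diff_distrib)
  ultimately show "f (a + l ((1 - t) *\<^sub>R x + t *\<^sub>R z)) \<le> (1 - t) * f (a + l x) + t * f (a + l z)"
    by simp
qed auto

lemma convex_on_above_tangent:
  fixes f :: "'a::real_inner \<Rightarrow> real"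
  assumes "convex_on UNIV f" and "GDERIV f x :> D"
  shows "f x + (z - x) \<bullet> D \<le> f z"
proof -
  have "convex_on UNIV (\<lambda>s. f (x + s *\<^sub>R (z - x)))"
    using assms(1) by (rule convex_on_compose_affine) (auto intro: bounded_linear_scaleR_left bounded_linear.linear)
  moreover have "((\<lambda>s. f (x + s *\<^sub>R (z - x))) has_real_derivative (z - x) \<bullet> D) (at 0)"
    using assms(2) by (intro GDERIV_along_line) simp
  ultimately have "f (x + 1 *\<^sub>R (z - x)) - f (x + 0 *\<^sub>R (z - x)) \<ge> (z - x) \<bullet> D * (1 - 0)"
    by (intro convex_on_imp_above_tangent[of UNIV]) auto
  then show ?thesis
    by simp
qed

lemma smooth_with_descent:
  fixes f :: "'a::euclidean_space \<Rightarrow> real"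
  assumes "smooth_with L f"
  shows "f (x + d) \<le> f x + d \<bullet> grad f x + L / 2 * (norm d)\<^sup>2"
proof -
  \<comment> \<open>\<open>\<phi>\<close> removes from \<open>f\<close> along the ray the linear and
    quadratic terms of the bound, so the claim is \<open>\<phi> 1 \<le> \<phi> 0\<close>; the
    Lipschitz gradient makes its slope nonpositive.\<close>
  define \<phi> where "\<phi> s = f (x + s *\<^sub>R d) - s * (d \<bullet> grad f x) - L / 2 * (norm d)\<^sup>2 * s\<^sup>2" for s
  have "\<exists>m. (\<phi> has_real_derivative m) (at s) \<and> m \<le> 0" if "0 \<le> s" for s
  proof (intro exI conjI)
    have "((\<lambda>s. f (x + s *\<^sub>R d)) has_real_derivative (d \<bullet> grad f (x + s *\<^sub>R d))) (at s)"
      using assms by (intro GDERIV_along_line differentiable_imp_gderiv_grad) (auto simp: smooth_with_def)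
    then show "(\<phi> has_real_derivative d \<bullet> grad f (x + s *\<^sub>R d) - d \<bullet> grad f x - L * (norm d)\<^sup>2 * s) (at s)"
      unfolding \<phi>_def by (auto intro!: derivative_eq_intros)
    have "d \<bullet> (grad f (x + s *\<^sub>R d) - grad f x) \<le> norm d * norm (grad f (x + s *\<^sub>R d) - grad f x)"
      by (rule norm_cauchy_schwarz)
    also have "\<dots> \<le> norm d * (L * norm (x - (x + s *\<^sub>R d)))"
      using assms unfolding smooth_with_def by (intro mult_left_mono norm_ge_zero) blast
    also have "\<dots> = L * (norm d)\<^sup>2 * s"
      using that by (simp add: power2_eq_square)
    finally show "d \<bullet> grad f (x + s *\<^sub>R d) - d \<bullet> grad f x - L * (norm d)\<^sup>2 * s \<le> 0"
      by (simp add: inner_diff_right)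
  qed
  then have "\<phi> 1 \<le> \<phi> 0"
    by (intro DERIV_nonpos_imp_nonincreasing[of 0 1 \<phi>]) auto
  then show ?thesis
    by (simp add: \<phi>_def)
qed

text \<open>Descent from \<open>w\<close> bounds both ends of the chord. With weights
  \<open>t\<close> and \<open>1 - t\<close> the gradient terms cancel, and
  \<open>t * (1 - t)\<^sup>2 + (1 - t) * t\<^sup>2 = t * (1 - t)\<close>.\<close>

lemma smooth_with_imp_chord_gap:
  fixes f :: "'a::euclidean_space \<Rightarrow> real"
  assumes "smooth_with L f"
  shows "chord_gap L f"
  unfolding chord_gap_def
proof (intro allI impI)
  fix w d :: 'a and t :: real
  assume t: "0 \<le> t \<and> t \<le> 1"
  let ?D = "d \<bullet> grad f w" and ?N = "(norm d)\<^sup>2"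
  have "f (w + (1 - t) *\<^sub>R d) \<le> f w + (1 - t) * ?D + L / 2 * ((1 - t)\<^sup>2 * ?N)"
    using smooth_with_descent[OF assms, of w "(1 - t) *\<^sub>R d"] by (simp add: power_mult_distrib)
  moreover have "f (w - t *\<^sub>R d) \<le> f w - t * ?D + L / 2 * (t\<^sup>2 * ?N)"
    using smooth_with_descent[OF assms, of w "- t *\<^sub>R d"] by (simp add: power_mult_distrib)
  ultimately have "t * f (w + (1 - t) *\<^sub>R d) + (1 - t) * f (w - t *\<^sub>R d)
    \<le> t * (f w + (1 - t) * ?D + L / 2 * ((1 - t)\<^sup>2 * ?N)) + (1 - t) * (f w - t * ?D + L / 2 * (t\<^sup>2 * ?N))"
    using t by (intro add_mono mult_left_mono) auto
  also have "\<dots> = f w + L / 2 * t * (1 - t) * ?N"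
    by (simp add: field_simps power2_eq_square)
  finally show "t * f (w + (1 - t) *\<^sub>R d) + (1 - t) * f (w - t *\<^sub>R d) \<le> f w + L / 2 * t * (1 - t) * ?N" .
qed

section \<open>From the chord gap back to smoothness, via subgradients\<close>

lemma convex_on_UNIV_subgradient:
  fixes g :: "'a::euclidean_space \<Rightarrow> real"
  assumes "convex_on UNIV g"
  obtains p where "\<And>z. g x + (z - x) \<bullet> p \<le> g z"
proof -
  let ?E = "epigraph UNIV g"
  \<comment> \<open>Otherwise the segment from \<open>(x, g x + 1)\<close> could be prolonged beyond
    \<open>(x, g x)\<close> inside the epigraph, reaching height
    \<open>g x + 1 - e < g x\<close>.\<close>
  have "(x, g x) \<notin> rel_interior ?E"
  proof
    assume "(x, g x) \<in> rel_interior ?E"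
    moreover have "convex ?E"
      using assms by (rule convex_epigraphI)
    moreover have "(x, g x + 1) \<in> affine hull ?E"
      by (rule hull_inc) (simp add: epigraph_def)
    ultimately obtain e where "e > 1" and "(1 - e) *\<^sub>R (x, g x + 1) + e *\<^sub>R (x, g x) \<in> ?E"
      using convex_rel_interior_if2 by blast
    then show False
      by (simp add: epigraph_def algebra_simps)
  qed
  moreover have "(x, g x) \<in> ?E" "convex ?E"
    using assms by (auto simp: mem_epigraph intro: convex_epigraphI)
  ultimately obtain a where "a \<noteq> 0" and a: "\<And>v. v \<in> ?E \<Longrightarrow> a \<bullet> (x, g x) \<le> a \<bullet> v"
    using supporting_hyperplane_rel_boundary[of ?E "(x, g x)"] by metis
  obtain q s where qs: "a = (q, s)"
    by force
  have ineq: "q \<bullet> x + s * g x \<le> q \<bullet> z + s * r" if "g z \<le> r" for z r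
    using a[of "(z, r)"] that by (simp add: qs epigraph_def)
  have "s \<ge> 0"
    using ineq[of x "g x + 1"] by (simp add: algebra_simps)
  \<comment> \<open>The supporting hyperplane is not vertical: the epigraph lies over the whole
    space, so a step along \<open>- q\<close> would cross it.\<close>
  moreover have "s \<noteq> 0"
  proof
    assume "s = 0"
    then have "q \<bullet> q \<le> 0"
      using ineq[of "x - q" "g (x - q)"] by (simp add: inner_diff_right)
    then have "q = 0"
      by (metis inner_eq_zero_iff inner_ge_zero order_antisym)
    then show False
      using \<open>a \<noteq> 0\<close> \<open>s = 0\<close> by (simp add: qs zero_prod_def)
  qed
  ultimately have "s > 0"
    by simp
  have "g x + (z - x) \<bullet> ((- 1 / s) *\<^sub>R q) \<le> g z" for z
    using ineq[of z "g z"] \<open>s > 0\<close>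
    by (simp add: field_simps inner_diff_left inner_diff_right inner_commute)
  then show thesis
    by (rule that)
qed

text \<open>Take a chord through \<open>x\<close> with \<open>x + e\<close> as one end. The
  subgradient bounds the other end from below, which turns the chord gap into an upper bound at
  \<open>x + e\<close>.\<close>

lemma chord_gap_subgradient_descent:
  fixes g :: "'a::real_inner \<Rightarrow> real"
  assumes "chord_gap L g" and p: "\<And>z. g x + (z - x) \<bullet> p \<le> g z"
  shows "g (x + e) \<le> g x + e \<bullet> p + L / 2 * (norm e)\<^sup>2"
proof -
  have "s * (g (x + e) - g x - e \<bullet> p) \<le> L / 2 * (norm e)\<^sup>2" if s: "0 < s" "s < 1" for s
  proof -
    \<comment> \<open>This choice puts the ends at \<open>x + e\<close> and
      \<open>x - (?t / s) *\<^sub>R e\<close>.\<close>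
    let ?t = "1 - s" and ?d = "(1 / s) *\<^sub>R e"
    have "?t * g (x + e) + s * g (x - ?t *\<^sub>R ?d) \<le> g x + L / 2 * ?t * s * (norm ?d)\<^sup>2"
      using assms(1)[unfolded chord_gap_def, rule_format, of ?t x ?d] s by simp
    moreover have "s * (g x - ?t / s * (e \<bullet> p)) \<le> s * g (x - ?t *\<^sub>R ?d)"
      using p[of "x - ?t *\<^sub>R ?d"] s by (intro mult_left_mono) auto
    moreover have "s * (g x - ?t / s * (e \<bullet> p)) = s * g x - ?t * (e \<bullet> p)"
      using s by (simp add: field_simps)
    moreover have "?t * (g (x + e) - g x - e \<bullet> p) = ?t * g (x + e) - (g x - s * g x) - ?t * (e \<bullet> p)"
      by (simp add: algebra_simps)
    ultimately have "?t * (g (x + e) - g x - e \<bullet> p) \<le> L / 2 * ?t * s * (norm ?d)\<^sup>2"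
      by linarith
    also have "\<dots> = ?t * (L / 2 * (norm e)\<^sup>2 / s)"
      using s by (simp add: power_divide power2_eq_square)
    finally have "g (x + e) - g x - e \<bullet> p \<le> L / 2 * (norm e)\<^sup>2 / s"
      by (rule mult_left_le_imp_le) (use s in simp)
    then show ?thesis
      using s by (simp add: field_simps)
  qed
  \<comment> \<open>Let \<open>s\<close> tend to 1, so that the other end approaches
    \<open>x\<close>.\<close>
  then have "g (x + e) - g x - e \<bullet> p \<le> L / 2 * (norm e)\<^sup>2"
    by (rule field_le_mult_one_interval)
  then show ?thesis
    by simp
qed

text \<open>The remainder of the linear approximation with slope \<open>p\<close> lies between 0, by
  the subgradient inequality, and a quadratic, by descent.\<close>

lemma chord_gap_subgradient_GDERIV:
  fixes g :: "'a::real_inner \<Rightarrow> real"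
  assumes "chord_gap L g" and p: "\<And>z. g x + (z - x) \<bullet> p \<le> g z"
  shows "GDERIV g x :> p"
  unfolding gderiv_def
proof (rule has_derivativeI_sandwich[where e = 1])
  show "bounded_linear (\<lambda>h. h \<bullet> p)"
    by (rule bounded_linear_inner_left)
  show "((\<lambda>z. L / 2 * norm (z - x)) \<longlongrightarrow> 0) (at x)"
    by (auto intro!: tendsto_eq_intros)
  fix z
  assume "z \<noteq> x"
  have "g z - g x - (z - x) \<bullet> p \<le> L / 2 * (norm (z - x))\<^sup>2"
    using chord_gap_subgradient_descent[OF assms, of "z - x"] by simp
  moreover have "0 \<le> g z - g x - (z - x) \<bullet> p"
    using p[of z] by simp
  ultimately show "norm (g z - g x - (z - x) \<bullet> p) / norm (z - x) \<le> L / 2 * norm (z - x)"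
    using \<open>z \<noteq> x\<close> by (simp add: field_simps power2_eq_square)
qed simp

lemma subgradient_cocoercive:
  fixes g :: "'a::real_inner \<Rightarrow> real"
  assumes "chord_gap L g" and "L > 0"
    and p: "\<And>w. g x + (w - x) \<bullet> p \<le> g w" and q: "\<And>w. g z + (w - z) \<bullet> q \<le> g w"
  shows "g x + (z - x) \<bullet> p + (norm (q - p))\<^sup>2 / (2 * L) \<le> g z"
proof -
  \<comment> \<open>compare the tangent at \<open>x\<close> with the descent bound at \<open>z\<close> after one gradient step
    for \<open>\<lambda>w. g w - w \<bullet> p\<close>\<close>
  let ?e = "(- 1 / L) *\<^sub>R (q - p)"
  have "g x + (z + ?e - x) \<bullet> p \<le> g (z + ?e)"
    by (rule p)
  also have "\<dots> \<le> g z + ?e \<bullet> q + L / 2 * (norm ?e)\<^sup>2"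
    by (rule chord_gap_subgradient_descent[OF assms(1) q])
  finally have "g x + (z - x) \<bullet> p \<le> g z + ?e \<bullet> (q - p) + L / 2 * (norm ?e)\<^sup>2"
    by (simp only: inner_add_left inner_diff_left inner_diff_right)
  also have "?e \<bullet> (q - p) = - ((norm (q - p))\<^sup>2 / L)"
    by (simp only: inner_scaleR_left power2_norm_eq_inner) simp
  also have "norm ?e = norm (q - p) / L"
    using \<open>L > 0\<close> by (simp only: norm_scaleR) simp
  also have "g z + - ((norm (q - p))\<^sup>2 / L) + L / 2 * (norm (q - p) / L)\<^sup>2 = g z - (norm (q - p))\<^sup>2 / (2 * L)"
    using \<open>L > 0\<close> by (simp add: field_simps power2_eq_square)
  finally show ?thesis
    by simp
qed

text \<open>Any selection \<open>P\<close> of subgradients is the gradient field, so it remains to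
  show that \<open>P\<close> is Lipschitz.\<close>

lemma convex_chord_gap_imp_smooth_with:
  fixes g :: "'a::euclidean_space \<Rightarrow> real"
  assumes "convex_on UNIV g" and gap: "chord_gap L g" and "L > 0"
  shows "smooth_with L g"
proof -
  have "\<exists>p. \<forall>z. g x + (z - x) \<bullet> p \<le> g z" for x
    using convex_on_UNIV_subgradient[OF assms(1)] by blast
  then obtain P where P: "\<And>x z. g x + (z - x) \<bullet> P x \<le> g z"
    by metis
  have D: "GDERIV g x :> P x" for x
    using gap P by (rule chord_gap_subgradient_GDERIV)
  have "norm (P z - P x) \<le> L * norm (x - z)" for x z
  proof -
    let ?n = "norm (P z - P x)"
    have "g x + (z - x) \<bullet> P x + ?n\<^sup>2 / (2 * L) \<le> g z"
      by (rule subgradient_cocoercive[OF gap \<open>L > 0\<close> P P])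
    moreover have "g z + (x - z) \<bullet> P z + ?n\<^sup>2 / (2 * L) \<le> g x"
      using subgradient_cocoercive[OF gap \<open>L > 0\<close> P P, of z x] by (simp add: norm_minus_commute)
    \<comment> \<open>Adding the two inequalities cancels the values of \<open>g\<close> and leaves
      cocoercivity of \<open>P\<close>; Cauchy-Schwarz and division by \<open>?n\<close> then give
      the Lipschitz bound.\<close>
    ultimately have "?n\<^sup>2 / (2 * L) + ?n\<^sup>2 / (2 * L) \<le> (z - x) \<bullet> (P z - P x)"
      by (simp add: inner_diff_left inner_diff_right)
    also have "\<dots> \<le> norm (z - x) * ?n"
      by (rule norm_cauchy_schwarz)
    finally have "?n * ?n \<le> (L * norm (x - z)) * ?n"
      using \<open>L > 0\<close> by (simp add: field_simps power2_eq_square norm_minus_commute)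
    then show ?thesis
      using \<open>L > 0\<close> by (cases "?n = 0") (auto simp: mult_le_cancel_right)
  qed
  then show ?thesis
    using D gderiv_grad[OF D] by (auto simp: smooth_with_def gderiv_def differentiable_def)
qed

section \<open>The convex hull of the interpolants and its closure\<close>

lemma conv_funs_chord_gap:
  fixes g :: "'a::real_inner \<Rightarrow> real"
  assumes H: "\<And>h. h \<in> H \<Longrightarrow> chord_gap L h" and g: "\<And>x. conv_funs H x = ereal (g x)"
  shows "chord_gap L g"
  unfolding chord_gap_def
proof (intro allI impI)
  fix w d :: 'a and t :: real
  assume t: "0 \<le> t \<and> t \<le> 1"
  have g_le: "g x \<le> h x" if "h \<in> H" for h x
    using conv_funs_greatest(2)[OF that, of x] by (simp add: g)
  have "conv_funs H = (\<lambda>x. ereal (g x))"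
    using g by blast
  then have "convex_on UNIV g"
    using conv_funs_greatest(1)[of H] by (simp add: ereal_convex_ereal_iff)
  then have shift: "convex_on UNIV (\<lambda>x. g (x + a))" for a
    using convex_on_compose_affine[of g "\<lambda>x. x" a] by (simp add: add.commute linear_id[unfolded id_def])
  \<comment> \<open>Since \<open>t\<close> and \<open>d\<close> are fixed, the quadratic term is
    constant in \<open>x\<close> and does not disturb convexity.\<close>
  define k where
    "k x = t * g (x + (1 - t) *\<^sub>R d) + (1 - t) * g (x - t *\<^sub>R d) + - (L / 2 * t * (1 - t) * (norm d)\<^sup>2)" for x
  have "convex_on UNIV k"
    unfolding k_def using t shift[of "(1 - t) *\<^sub>R d"] shift[of "- t *\<^sub>R d"]
    by (intro convex_on_add convex_on_cmul) (auto simp: convex_on_const)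
  then have "ereal_convex (\<lambda>x. ereal (k x))"
    by (simp add: ereal_convex_ereal_iff)
  moreover have "ereal (k x) \<le> ereal (h x)" if "h \<in> H" for h x
  proof -
    have "k x \<le> t * h (x + (1 - t) *\<^sub>R d) + (1 - t) * h (x - t *\<^sub>R d) + - (L / 2 * t * (1 - t) * (norm d)\<^sup>2)"
      unfolding k_def using t g_le[OF that] by (intro add_mono mult_left_mono) auto
    also have "\<dots> \<le> h x"
      using H[OF that, unfolded chord_gap_def, rule_format, of t x d] t by simp
    finally show ?thesis
      by simp
  qed
  ultimately have "ereal (k w) \<le> conv_funs H w"
    by (rule conv_funs_greatest(3))
  then show "t * g (w + (1 - t) *\<^sub>R d) + (1 - t) * g (w - t *\<^sub>R d) \<le> g w + L / 2 * t * (1 - t) * (norm d)\<^sup>2"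
    by (simp add: k_def g)
qed

lemma lower_semicontinuous_ereal:
  assumes "continuous_on UNIV g"
  shows "lower_semicontinuous (\<lambda>x. ereal (g x))"
  unfolding lower_semicontinuous_def
proof
  fix c
  have "continuous_on UNIV (\<lambda>x. ereal (g x))"
    using assms by (rule continuous_on_ereal)
  then show "open {x. c < ereal (g x)}"
    by (intro open_Collect_less continuous_on_const)
qed

lemma conv_smooth_interpolants:
  fixes f :: "'a::euclidean_space \<Rightarrow> real"
  assumes "L > 0" and "convex_on UNIV f" and "smooth_with L f" and "I \<noteq> {}"
  obtains g where "g \<in> smooth_interpolants L f y I"
    and "conv_funs (smooth_interpolants L f y I) = (\<lambda>x. ereal (g x))"
proof -
  let ?H = "smooth_interpolants L f y I"
  have f: "f \<in> ?H"
    using assms by (simp add: smooth_interpolants_def)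
  \<comment> \<open>The tangent of \<open>f\<close> at \<open>y i\<close> is also the tangent of
    every member there. Being affine, it is a convex minorant of the family and hence of the
    hull.\<close>
  define T where "T i x = f (y i) + (x - y i) \<bullet> grad f (y i)" for i x
  have T_le: "ereal (T i x) \<le> conv_funs ?H x" if i: "i \<in> I" for i x
  proof (rule conv_funs_greatest(3))
    show "ereal_convex (\<lambda>x. ereal (T i x))"
      unfolding ereal_convex_ereal_iff T_def
      by (rule convex_onI) (auto simp: algebra_simps inner_add_left inner_diff_left)
    fix h x
    assume h: "h \<in> ?H"
    then have "GDERIV h (y i) :> grad h (y i)"
      by (intro differentiable_imp_gderiv_grad) (simp add: smooth_interpolants_def smooth_with_def)
    then have "h (y i) + (x - y i) \<bullet> grad h (y i) \<le> h x"
      using h by (intro convex_on_above_tangent) (simp add: smooth_interpolants_def)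
    then show "ereal (T i x) \<le> ereal (h x)"
      using h i by (simp add: smooth_interpolants_def T_def)
  qed
  \<comment> \<open>\<open>real_of_ereal\<close> sends infinite values to 0, so finiteness must be
    shown: the hull lies between one tangent, available as \<open>I \<noteq> {}\<close>, and
    \<open>f\<close> itself.\<close>
  define g where "g x = real_of_ereal (conv_funs ?H x)" for x
  have g: "conv_funs ?H x = ereal (g x)" for x
  proof -
    obtain i where "i \<in> I"
      using \<open>I \<noteq> {}\<close> by blast
    then have "ereal (T i x) \<le> conv_funs ?H x" "conv_funs ?H x \<le> ereal (f x)"
      using T_le conv_funs_greatest(2)[OF f] by auto
    then show ?thesis
      unfolding g_def by (cases "conv_funs ?H x") auto
  qed
  then have g': "conv_funs ?H = (\<lambda>x. ereal (g x))"
    by blast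
  have conv: "convex_on UNIV g"
    using conv_funs_greatest(1)[of ?H] by (simp add: g' ereal_convex_ereal_iff)
  have gap: "chord_gap L g"
    by (rule conv_funs_chord_gap[OF _ g])
      (auto intro: smooth_with_imp_chord_gap simp: smooth_interpolants_def)
  have "g (y i) = f (y i) \<and> grad g (y i) = grad f (y i)" if "i \<in> I" for i
  proof
    show eq: "g (y i) = f (y i)"
      using T_le[OF that, of "y i"] conv_funs_greatest(2)[OF f, of "y i"] by (simp add: g T_def)
    \<comment> \<open>\<open>g\<close> meets the minorant \<open>T i\<close> at \<open>y i\<close>,
      so the slope of \<open>T i\<close> is a subgradient of \<open>g\<close> there, and the chord
      gap makes it the gradient.\<close>
    have "g (y i) + (z - y i) \<bullet> grad f (y i) \<le> g z" for z
      using T_le[OF that, of z] by (simp add: g T_def eq)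
    then show "grad g (y i) = grad f (y i)"
      by (intro gderiv_grad chord_gap_subgradient_GDERIV[OF gap])
  qed
  then have "g \<in> ?H"
    using conv convex_chord_gap_imp_smooth_with[OF conv gap \<open>L > 0\<close>]
    by (simp add: smooth_interpolants_def)
  then show thesis
    using g' by (rule that)
qed

theorem lemma6:
  fixes f :: "real ^ 'n \<Rightarrow> real" and L :: real
    and y :: "'i \<Rightarrow> real ^ 'n" and I :: "'i set"
    and f\<^sub>j :: "real ^ 'n \<Rightarrow> ereal"
  defines "f\<^sub>j \<equiv> cl_fun (conv_funs (smooth_interpolants L f y I))"
  assumes "L > 0" and "convex_on UNIV f" and "smooth_with L f"
    and "finite I" and "I \<noteq> {}"
  shows "f\<^sub>j \<in> (\<lambda>g x. ereal (g x)) ` smooth_interpolants L f y I \<and>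
    f\<^sub>j = conv_funs (smooth_interpolants L f y I) \<and>
    (\<forall>g \<in> smooth_interpolants L f y I. \<forall>x. f\<^sub>j x \<le> ereal (g x))"
proof -
  let ?H = "smooth_interpolants L f y I"
  obtain g where g: "g \<in> ?H" and conv: "conv_funs ?H = (\<lambda>x. ereal (g x))"
    by (rule conv_smooth_interpolants[OF assms(2-4,6)])
  \<comment> \<open>A finite convex function on a finite-dimensional space is continuous, so taking
    the closure does not change the hull.\<close>
  have "continuous_on UNIV g"
    using g by (intro convex_on_continuous) (auto simp: smooth_interpolants_def)
  then have "lower_semicontinuous (conv_funs ?H)"
    unfolding conv by (rule lower_semicontinuous_ereal)
  then have "f\<^sub>j = conv_funs ?H"
    unfolding f\<^sub>j_def by (intro antisym cl_fun_greatest) auto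
  moreover have "conv_funs ?H \<in> (\<lambda>g x. ereal (g x)) ` ?H"
    unfolding conv using g by (rule imageI)
  ultimately show ?thesis
    by (simp add: conv_funs_greatest(2))
qed

end
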